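(* Let $0<p<\infty$, $n$ a positive integer, and $A\in W^{n-1,q}(D,\mathbb{B})$ with $q>2$. Let $f:D\to\mathbb{B}$ have the representation $$f=\sum_{k=0}^{n-1}\widehat{z^*}^{\,k}\,\varphi_k,\qquad \varphi_k\in H_{A,0}(D,\mathbb{B}).$$ Then $f\in V^{n,p}_{A,0}(D,\mathbb{B})$ if and only if $\varphi_k\in H^p_{A,0}(D,\mathbb{B})$ for every $k$.
   Context: $D$ is the open unit disk in $\mathbb{C}$. For $u=x+iy\in\mathbb{C}$, $u^*=x-iy$. $\mathbb{B}$ denotes the bicomplex numbers: the commutative $\mathbb{C}$-algebra of elements $z_1+jz_2$ with $z_1,z_2\in\mathbb{C}$, $j^2=-1$, $ij=ji$. Put $p^\pm=\frac12(1\pm ij)$. Each $w=z_1+jz_2\in\mathbb{B}$ is uniquely $w=p^+w^++p^-w^-$ with $w^\pm=z_1\mp iz_2\in\mathbb{C}$, and $\|w\|_{\mathbb{B}}=\sqrt{(|w^+|^2+|w^-|^2)/2}$. The bicomplexification of $u=x+iy$ is $\widehat u=x+jy\in\mathbb{B}$; thus $\widehat{z^*}=x-jy$ for $z=x+iy$. $W^{n-1,q}(D,\mathbb{B})$ is the Sobolev space of $\mathbb{B}$-valued functions on $D$ whose components are in the usual Sobolev space $W^{n-1,q}(D)$ (with $W^{0,q}=L^q$). $\bar\partial=\frac12(\partial_x+j\partial_y)$. For $0<p<\infty$, $\|f\|_{H^p_{\mathbb{B}}}=\sup_{0<r<1}\left(\int_0^{2\pi}\|f(re^{i\theta})\|_{\mathbb{B}}^p\,d\theta\right)^{1/p}$.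 $H_{A,0}(D,\mathbb{B})$ is the set of $f:D\to\mathbb{B}$ with $\bar\partial f=Af$ (taken with their continuous representatives), and $H^p_{A,0}(D,\mathbb{B})$ is the subset of those with $\|f\|_{H^p_{\mathbb{B}}}<\infty$. $V^{n,p}_{A,0}(D,\mathbb{B})$ is the set of $f:D\to\mathbb{B}$ with $(\bar\partial-A)^nf=0$ and $\sum_{k=0}^{n-1}\|(\bar\partial-A)^kf\|_{H^p_{\mathbb{B}}}<\infty$, where $A$ acts by multiplication. Derivatives are understood in the weak sense, the iterates being locally integrable functions obtained successively (and taken with their continuous representatives). *)

theory Defs
  imports "HOL-Analysis.Analysis"
begin
text \<open>\<open>Bicomplex z\<^sub>1 z\<^sub>2\<close> stands for \<open>z\<^sub>1 + j z\<^sub>2\<close>.\<close>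

codatatype bicomplex = Bicomplex (bc1: complex) (bc2: complex)

lemma bicomplex_eqI [intro?]: "bc1 v = bc1 w \<Longrightarrow> bc2 v = bc2 w \<Longrightarrow> v = w"
  by (rule bicomplex.expand) simp

lemma bicomplex_eq_iff: "v = w \<longleftrightarrow> bc1 v = bc1 w \<and> bc2 v = bc2 w"
  by (auto intro: bicomplex.expand)

instantiation bicomplex :: comm_ring_1
begin

primcorec zero_bicomplex where
  "bc1 0 = 0"
| "bc2 0 = 0"

primcorec one_bicomplex where
  "bc1 1 = 1"
| "bc2 1 = 0"

primcorec plus_bicomplex where
  "bc1 (v + w) = bc1 v + bc1 w"
| "bc2 (v + w) = bc2 v + bc2 w"

primcorec uminus_bicomplex where
  "bc1 (- w) = - bc1 w"
| "bc2 (- w) = - bc2 w"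

primcorec minus_bicomplex where
  "bc1 (v - w) = bc1 v - bc1 w"
| "bc2 (v - w) = bc2 v - bc2 w"

primcorec times_bicomplex where
  "bc1 (v * w) = bc1 v * bc1 w - bc2 v * bc2 w"
| "bc2 (v * w) = bc1 v * bc2 w + bc2 v * bc1 w"

instance
  by standard (simp_all add: bicomplex_eq_iff algebra_simps)

end

definition bc_j :: bicomplex where
  "bc_j = Bicomplex 0 1"

lemma bc_j_square: "bc_j * bc_j = - 1"
  by (simp add: bicomplex_eq_iff bc_j_def)

definition bc_of_complex :: "complex \<Rightarrow> bicomplex" where
  "bc_of_complex z = Bicomplex z 0"

lemma bicomplex_eq: "w = bc_of_complex (bc1 w) + bc_j * bc_of_complex (bc2 w)"
  by (simp add: bicomplex_eq_iff bc_j_def bc_of_complex_def)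

text \<open>The idempotent components \<open>w\<^sup>+\<close> and \<open>w\<^sup>-\<close>.\<close>

definition bc_plus :: "bicomplex \<Rightarrow> complex" where
  "bc_plus w = bc1 w - \<i> * bc2 w"

definition bc_minus :: "bicomplex \<Rightarrow> complex" where
  "bc_minus w = bc1 w + \<i> * bc2 w"

lemma bicomplex_idempotent_representation:
  "w = bc_of_complex (1/2) * (1 + bc_of_complex \<i> * bc_j) * bc_of_complex (bc_plus w)
     + bc_of_complex (1/2) * (1 - bc_of_complex \<i> * bc_j) * bc_of_complex (bc_minus w)"
  by (simp add: bicomplex_eq_iff bc_j_def bc_of_complex_def bc_plus_def bc_minus_def field_simps)

instantiation bicomplex :: real_algebra_1
begin

primcorec scaleR_bicomplex where
  "bc1 (scaleR r w) = scaleR r (bc1 w)"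
| "bc2 (scaleR r w) = scaleR r (bc2 w)"

instance
  by standard (simp_all add: bicomplex_eq_iff algebra_simps)

end

lemma bc_plus_minus_square:
  "((cmod (bc_plus w))\<^sup>2 + (cmod (bc_minus w))\<^sup>2) / 2 = bc1 w \<bullet> bc1 w + bc2 w \<bullet> bc2 w"
  unfolding bc_plus_def bc_minus_def cmod_power2 inner_complex_def
  by (simp add: power2_eq_square algebra_simps)

instantiation bicomplex :: real_inner
begin

definition inner_bicomplex :: "bicomplex \<Rightarrow> bicomplex \<Rightarrow> real" where
  "inner_bicomplex v w = bc1 v \<bullet> bc1 w + bc2 v \<bullet> bc2 w"

definition norm_bicomplex :: "bicomplex \<Rightarrow> real" where
  "norm_bicomplex w = sqrt (((cmod (bc_plus w))\<^sup>2 + (cmod (bc_minus w))\<^sup>2) / 2)"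

definition sgn_bicomplex :: "bicomplex \<Rightarrow> bicomplex" where
  "sgn_bicomplex w = w /\<^sub>R norm w"

definition dist_bicomplex :: "bicomplex \<Rightarrow> bicomplex \<Rightarrow> real" where
  "dist_bicomplex v w = norm (v - w)"

definition uniformity_bicomplex :: "(bicomplex \<times> bicomplex) filter" where
  "uniformity_bicomplex = (INF e\<in>{0<..}. principal {(v, w). dist v w < e})"

definition open_bicomplex :: "bicomplex set \<Rightarrow> bool" where
  "open_bicomplex U \<longleftrightarrow> (\<forall>v\<in>U. eventually (\<lambda>(v', w). v' = v \<longrightarrow> w \<in> U) uniformity)"

instance
proof
  fix u v w :: bicomplex and r :: real
  show "norm w = sqrt (w \<bullet> w)"
    unfolding norm_bicomplex_def inner_bicomplex_def bc_plus_minus_square ..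
  show "0 \<le> w \<bullet> w"
    by (simp add: inner_bicomplex_def)
  show "w \<bullet> w = 0 \<longleftrightarrow> w = 0"
    by (simp add: inner_bicomplex_def bicomplex_eq_iff add_nonneg_eq_0_iff)
  show "v \<bullet> w = w \<bullet> v"
    by (simp add: inner_bicomplex_def inner_commute)
  show "(u + v) \<bullet> w = u \<bullet> w + v \<bullet> w"
    by (simp add: inner_bicomplex_def inner_add_left)
  show "(r *\<^sub>R v) \<bullet> w = r * (v \<bullet> w)"
    by (simp add: inner_bicomplex_def algebra_simps)
qed (rule sgn_bicomplex_def dist_bicomplex_def uniformity_bicomplex_def open_bicomplex_def)+

end

instantiation bicomplex :: euclidean_space
begin

definition Basis_bicomplex :: "bicomplex set" where
  "Basis_bicomplex = (\<lambda>b. Bicomplex b 0) ` Basis \<union> (\<lambda>b. Bicomplex 0 b) ` Basis"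

instance
proof
  show "(Basis :: bicomplex set) \<noteq> {}"
    by (simp add: Basis_bicomplex_def)
  show "finite (Basis :: bicomplex set)"
    by (simp add: Basis_bicomplex_def)
  show "u \<bullet> v = (if u = v then 1 else 0)"
    if "u \<in> Basis" "v \<in> Basis" for u v :: bicomplex
    using that by (auto simp: Basis_bicomplex_def inner_bicomplex_def inner_Basis split: if_splits)
  show "(\<forall>u\<in>Basis. w \<bullet> u = 0) \<longleftrightarrow> w = 0" for w :: bicomplex
    by (auto simp: Basis_bicomplex_def inner_bicomplex_def bicomplex_eq_iff ball_Un
        euclidean_all_zero_iff)
qed

end

text \<open>The bicomplexification \<open>x + j y\<close> of \<open>x + i y\<close>.\<close>

definition bc_hat :: "complex \<Rightarrow> bicomplex" where
  "bc_hat u = of_real (Re u) + bc_j * of_real (Im u)"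

abbreviation unit_disk :: "complex set" where
  "unit_disk \<equiv> ball 0 1"

definition dderiv :: "'a \<Rightarrow> ('a::real_normed_vector \<Rightarrow> 'b::real_normed_vector) \<Rightarrow> 'a \<Rightarrow> 'b" where
  "dderiv v f x = frechet_derivative f (at x) v"

text \<open>For \<open>f\<close> defined on \<open>\<complex>\<close>, \<open>dderiv 1 f\<close> and \<open>dderiv \<i> f\<close> are the partial derivatives with
  respect to \<open>x\<close> and \<open>y\<close>.\<close>

primrec continuously_differentiable ::
    "nat \<Rightarrow> ('a::real_normed_vector \<Rightarrow> 'b::real_normed_vector) \<Rightarrow> bool" where
  "continuously_differentiable 0 f \<longleftrightarrow> continuous_on UNIV f"
| "continuously_differentiable (Suc k) f \<longleftrightarrow>
     (\<forall>x. f differentiable (at x)) \<and> (\<forall>v. continuously_differentiable k (dderiv v f))"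

definition test_function :: "(complex \<Rightarrow> real) \<Rightarrow> bool" where
  "test_function \<psi> \<longleftrightarrow> (\<forall>k. continuously_differentiable k \<psi>) \<and>
     compact (closure {z. \<psi> z \<noteq> 0}) \<and> closure {z. \<psi> z \<noteq> 0} \<subseteq> unit_disk"

definition locally_integrable ::
    "(complex \<Rightarrow> 'b::{banach, second_countable_topology}) \<Rightarrow> bool" where
  "locally_integrable f \<longleftrightarrow>
     (\<forall>K. compact K \<and> K \<subseteq> unit_disk \<longrightarrow> set_integrable lebesgue K f)"

text \<open>\<open>g\<close> is the weak derivative of \<open>f\<close>, \<open>a\<close> times in \<open>x\<close> and \<open>b\<close> times in \<open>y\<close>.\<close>

definition weak_partial :: "nat \<Rightarrow> nat \<Rightarrow> (complex \<Rightarrow> complex) \<Rightarrow> (complex \<Rightarrow> complex) \<Rightarrow> bool" where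
  "weak_partial a b f g \<longleftrightarrow> locally_integrable f \<and> locally_integrable g \<and>
     (\<forall>\<psi>. test_function \<psi> \<longrightarrow>
        (LINT z:unit_disk|lebesgue. \<psi> z *\<^sub>R g z) =
          (-1) ^ (a + b) *
          (LINT z:unit_disk|lebesgue. (dderiv 1 ^^ a) ((dderiv \<i> ^^ b) \<psi>) z *\<^sub>R f z))"

text \<open>The exponent \<open>q = \<infinity>\<close> is admitted.\<close>

definition Lspace_disk :: "ereal \<Rightarrow> (complex \<Rightarrow> complex) set" where
  "Lspace_disk q = {f. set_borel_measurable lebesgue unit_disk f \<and>
     (if q = \<infinity> then \<exists>C. AE z in lebesgue. z \<in> unit_disk \<longrightarrow> norm (f z) \<le> C
      else set_integrable lebesgue unit_disk (\<lambda>z. norm (f z) powr real_of_ereal q))}"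

definition sobolev_disk :: "nat \<Rightarrow> ereal \<Rightarrow> (complex \<Rightarrow> complex) set" where
  "sobolev_disk m q = {f \<in> Lspace_disk q.
     \<forall>a b. 1 \<le> a + b \<and> a + b \<le> m \<longrightarrow> (\<exists>g \<in> Lspace_disk q. weak_partial a b f g)}"

definition sobolev_disk_bc :: "nat \<Rightarrow> ereal \<Rightarrow> (complex \<Rightarrow> bicomplex) set" where
  "sobolev_disk_bc m q =
     {f. (\<lambda>z. bc1 (f z)) \<in> sobolev_disk m q \<and> (\<lambda>z. bc2 (f z)) \<in> sobolev_disk m q}"

text \<open>\<open>dbar \<psi> = (\<partial>\<^sub>x \<psi> + j \<partial>\<^sub>y \<psi>) / 2\<close> for a differentiable real-valued \<open>\<psi>\<close>; \<open>weak_dbar f g\<close> says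
  that \<open>g\<close> is the same operator applied to \<open>f\<close> in the weak sense.\<close>

definition dbar :: "(complex \<Rightarrow> real) \<Rightarrow> complex \<Rightarrow> bicomplex" where
  "dbar \<psi> z = (1/2) *\<^sub>R (of_real (dderiv 1 \<psi> z) + bc_j * of_real (dderiv \<i> \<psi> z))"

definition weak_dbar :: "(complex \<Rightarrow> bicomplex) \<Rightarrow> (complex \<Rightarrow> bicomplex) \<Rightarrow> bool" where
  "weak_dbar f g \<longleftrightarrow> locally_integrable f \<and> locally_integrable g \<and>
     (\<forall>\<psi>. test_function \<psi> \<longrightarrow>
        (LINT z:unit_disk|lebesgue. \<psi> z *\<^sub>R g z) =
          - (LINT z:unit_disk|lebesgue. dbar \<psi> z * f z))"

definition ennreal_powr :: "ennreal \<Rightarrow> real \<Rightarrow> ennreal" where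
  "ennreal_powr x a = (if x = \<infinity> then \<infinity> else ennreal (enn2real x powr a))"

definition hardy_norm :: "real \<Rightarrow> (complex \<Rightarrow> bicomplex) \<Rightarrow> ennreal" where
  "hardy_norm p f = (SUP r\<in>{0<..<1}. ennreal_powr
     (\<integral>\<^sup>+\<theta>\<in>{0..2*pi}. ennreal (norm (f (of_real r * cis \<theta>)) powr p) \<partial>lborel) (1 / p))"

text \<open>Elements of the spaces below are total functions; their values off the disk play no role.
  On the disk they are the continuous representatives.\<close>

definition vekua_solutions :: "(complex \<Rightarrow> bicomplex) \<Rightarrow> (complex \<Rightarrow> bicomplex) set" where
  "vekua_solutions A = {f. continuous_on unit_disk f \<and> weak_dbar f (\<lambda>z. A z * f z)}"

definition vekua_hardy :: "real \<Rightarrow> (complex \<Rightarrow> bicomplex) \<Rightarrow> (complex \<Rightarrow> bicomplex) set" where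
  "vekua_hardy p A = {f \<in> vekua_solutions A. hardy_norm p f < \<infinity>}"

text \<open>\<open>vekua_iterates A n f g\<close>: for \<open>k \<le> n\<close>, \<open>g k\<close> is \<open>(dbar - A)\<^sup>k f\<close>. On the disk \<open>g\<close> is
  determined by \<open>f\<close>, since weak derivatives are unique almost everywhere and each \<open>g k\<close> is
  continuous.\<close>

definition vekua_iterates :: "(complex \<Rightarrow> bicomplex) \<Rightarrow> nat \<Rightarrow> (complex \<Rightarrow> bicomplex) \<Rightarrow>
    (nat \<Rightarrow> complex \<Rightarrow> bicomplex) \<Rightarrow> bool" where
  "vekua_iterates A n f g \<longleftrightarrow> g 0 = f \<and> (\<forall>k\<le>n. continuous_on unit_disk (g k)) \<and>
     (\<forall>k<n. weak_dbar (g k) (\<lambda>z. A z * g k z + g (Suc k) z))"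

definition meta_vekua_hardy ::
    "nat \<Rightarrow> real \<Rightarrow> (complex \<Rightarrow> bicomplex) \<Rightarrow> (complex \<Rightarrow> bicomplex) set" where
  "meta_vekua_hardy n p A = {f. \<exists>g. vekua_iterates A n f g \<and>
     (\<forall>z\<in>unit_disk. g n z = 0) \<and> (\<Sum>k<n. hardy_norm p (g k)) < \<infinity>}"

end

theory Submission
  imports Defs "HOL-Real_Asymp.Real_Asymp"
begin

text \<open>Write \<open>\<partial>\<close> for the weak operator \<open>(\<partial>\<^sub>x + j \<partial>\<^sub>y) / 2\<close> and \<open>h(z) = x - j y\<close> for the bicomplexification
  of the conjugate. The whole argument rests on \<open>\<partial> h = 1\<close>. If \<open>\<partial> \<phi> = A \<phi>\<close>, the product rule gives
  \<open>(\<partial> - A) (h\<^sup>k \<phi>) = k h\<^sup>k\<^sup>-\<^sup>1 \<phi>\<close>, so \<open>\<partial> - A\<close> acts on \<open>f = \<Sum>\<^sub>k h\<^sup>k \<phi>\<^sub>k\<close> like the derivative on a polynomial in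
  \<open>h\<close> with coefficients \<open>\<phi>\<^sub>k\<close>: it produces \<open>\<Sum>\<^sub>k h\<^sup>k (k + 1) \<phi>\<^sub>k\<^sub>+\<^sub>1\<close>, which has one term less and whose
  coefficients again solve the Vekua equation (\<open>weak_dbar_polyanalytic\<close>).

  This allows an induction on the number \<open>n\<close> of terms (\<open>meta_vekua_hardy_iff_components\<close>). Membership of
  \<open>f\<close> in the meta-class of order \<open>n + 1\<close> means that \<open>f\<close> has finite Hardy norm and that \<open>(\<partial> - A) f\<close> is in
  the meta-class of order \<open>n\<close> (\<open>meta_vekua_hardy_Suc_iff\<close>). By induction the latter says that all \<open>\<phi>\<^sub>k\<close>
  with \<open>k \<ge> 1\<close> have finite Hardy norm, and then \<open>f\<close> has finite Hardy norm if and only if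
  \<open>\<phi>\<^sub>0 = f - \<Sum>\<^sub>k\<^sub>\<ge>\<^sub>1 h\<^sup>k \<phi>\<^sub>k\<close> has. This uses only that the continuous functions of finite Hardy norm form a
  vector space, also for \<open>p < 1\<close>, and that multiplication by \<open>h\<close> preserves it; in fact \<open>\<parallel>h w\<parallel> = \<bar>z\<bar> \<parallel>w\<parallel>\<close> holds
  for every bicomplex \<open>w\<close> (\<open>norm_bc_hat_cnj_mult\<close>).

  The meta-class asserts the existence of some continuous weak iterates. To identify them with the
  ones computed by the product rule one needs that a continuous function annihilated by all
  test functions vanishes (\<open>continuous_eq_0_if_test_integrals_0\<close>), hence enough smooth bump
  functions.\<close>

section \<open>Smooth functions and bump functions\<close>

lemma dderiv_eq: "(f has_derivative f') (at z) \<Longrightarrow> dderiv v f z = f' v"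
  by (simp add: dderiv_def frechet_derivative_at[symmetric])

lemma has_derivative_dderiv:
  "f differentiable (at z) \<Longrightarrow> (f has_derivative (\<lambda>v. dderiv v f z)) (at z)"
  by (simp add: dderiv_def frechet_derivative_works[symmetric])

lemma continuously_differentiable_Suc_imp:
  "continuously_differentiable (Suc k) f \<Longrightarrow> continuously_differentiable k f"
proof (induction k arbitrary: f)
  case 0
  then show ?case
    by (auto simp: continuous_on_eq_continuous_at intro: differentiable_imp_continuous_within)
qed auto

lemma continuously_differentiable_const:
  "continuously_differentiable k (\<lambda>z. c)"
proof (induction k arbitrary: c)
  case (Suc k)
  have "dderiv v (\<lambda>z. c) = (\<lambda>z. 0)" for v :: 'a
    by (rule ext, subst dderiv_eq[OF has_derivative_const]) simp
  with Suc show ?case by simp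
qed simp

lemma continuously_differentiable_bounded_linear:
  assumes "bounded_linear f"
  shows "continuously_differentiable k f"
proof (cases k)
  case 0
  then show ?thesis using assms by (simp add: linear_continuous_on)
next
  case (Suc m)
  have d: "(f has_derivative f) (at z)" for z
    using assms by (rule bounded_linear_imp_has_derivative)
  have "dderiv v f = (\<lambda>z. f v)" for v
    by (rule ext) (rule dderiv_eq[OF d])
  then show ?thesis
    using d by (auto simp: Suc continuously_differentiable_const differentiable_def)
qed

lemma continuously_differentiable_add:
  assumes "continuously_differentiable k f" "continuously_differentiable k g"
  shows "continuously_differentiable k (\<lambda>z. f z + g z)"
  using assms
proof (induction k arbitrary: f g)
  case 0
  then show ?case by (auto intro: continuous_intros)
next
  case (Suc k)
  have "dderiv v (\<lambda>z. f z + g z) = (\<lambda>z. dderiv v f z + dderiv v g z)" for v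
    using Suc.prems
    by (intro ext dderiv_eq has_derivative_add has_derivative_dderiv) auto
  with Suc show ?case by auto
qed

lemma dderiv_mult:
  fixes f g :: "'a::real_normed_vector \<Rightarrow> real"
  assumes "f differentiable (at z)" "g differentiable (at z)"
  shows "dderiv v (\<lambda>z. f z * g z) z = f z * dderiv v g z + dderiv v f z * g z"
  using assms by (intro dderiv_eq has_derivative_mult has_derivative_dderiv)

lemma continuously_differentiable_mult:
  fixes f g :: "'a::real_normed_vector \<Rightarrow> real"
  assumes "continuously_differentiable k f" "continuously_differentiable k g"
  shows "continuously_differentiable k (\<lambda>z. f z * g z)"
  using assms
proof (induction k arbitrary: f g)
  case 0
  then show ?case by (auto intro: continuous_intros)
next
  case (Suc k)
  have "dderiv v (\<lambda>z. f z * g z) = (\<lambda>z. f z * dderiv v g z + dderiv v f z * g z)" for v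
    using Suc.prems by (intro ext dderiv_mult) auto
  moreover have "continuously_differentiable k f" "continuously_differentiable k g"
    using Suc.prems continuously_differentiable_Suc_imp by blast+
  ultimately show ?case
    using Suc by (auto intro!: continuously_differentiable_add)
qed

text \<open>The derivatives of the smooth step \<open>exp (- 1 / t)\<close> are combinations of \<open>exp (- 1 / t) / t\<^sup>m\<close>.
  Treating all \<open>m\<close> at once gives a family closed under differentiation up to linear combinations,
  so that smoothness follows by one induction.\<close>

definition flat_exp :: "nat \<Rightarrow> real \<Rightarrow> real" where
  "flat_exp m t = (if t \<le> 0 then 0 else exp (- 1 / t) / t ^ m)"

lemma flat_exp_tendsto_0: "(flat_exp m \<longlongrightarrow> 0) (at 0)"
proof -
  have "((\<lambda>t::real. exp (- 1 / t) / t ^ m) \<longlongrightarrow> 0) (at_right 0)"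
    by real_asymp
  then have "(flat_exp m \<longlongrightarrow> 0) (at_right 0)"
    by (rule Lim_transform_eventually)
      (auto simp: flat_exp_def eventually_at_right_field intro: exI[of _ 1])
  moreover have "(flat_exp m \<longlongrightarrow> 0) (at_left 0)"
    by (rule Lim_transform_eventually[OF tendsto_const])
      (auto simp: flat_exp_def eventually_at_left_field intro: exI[of _ "-1"])
  ultimately show ?thesis
    by (simp add: filterlim_split_at)
qed

lemma flat_exp_has_derivative:
  "(flat_exp m has_real_derivative flat_exp (m + 2) t - m * flat_exp (m + 1) t) (at t)"
proof -
  consider "t < 0" | "t = 0" | "t > 0" by linarith
  then show ?thesis
  proof cases
    case 1
    have "((\<lambda>t. 0) has_real_derivative 0) (at t)" by simp
    then have "(flat_exp m has_real_derivative 0) (at t)"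
      by (rule has_field_derivative_transform_within_open[of _ _ _ "{..<0}"])
        (use 1 in \<open>auto simp: flat_exp_def\<close>)
    with 1 show ?thesis by (simp add: flat_exp_def)
  next
    case 2
    \<comment> \<open>The difference quotient at \<open>0\<close> is the next member of the family.\<close>
    have "((\<lambda>y. (flat_exp m y - flat_exp m 0) / (y - 0)) \<longlongrightarrow> 0) (at 0)"
      by (rule Lim_transform_eventually[OF flat_exp_tendsto_0[of "m + 1"]])
        (auto simp: flat_exp_def eventually_at intro: exI[of _ 1])
    with 2 show ?thesis
      by (simp add: has_field_derivative_iff flat_exp_def)
  next
    case 3
    have "((\<lambda>t. exp (- 1 / t) / t ^ m) has_real_derivative
        (exp (- 1 / t) * (1 / t\<^sup>2) * t ^ m - exp (- 1 / t) * (m * t ^ (m - 1))) / (t ^ m * t ^ m)) (at t)"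
      using 3 by (auto intro!: derivative_eq_intros simp: power2_eq_square)
    also have "(exp (- 1 / t) * (1 / t\<^sup>2) * t ^ m - exp (- 1 / t) * (m * t ^ (m - 1))) / (t ^ m * t ^ m) =
        exp (- 1 / t) / t ^ (m + 2) - m * (exp (- 1 / t) / t ^ (m + 1))"
      using 3 by (cases m) (simp_all add: field_simps power2_eq_square)
    finally have "(flat_exp m has_real_derivative
        (exp (- 1 / t) / t ^ (m + 2) - m * (exp (- 1 / t) / t ^ (m + 1)))) (at t)"
      by (rule has_field_derivative_transform_within_open[of _ _ _ "{0<..}"])
        (use 3 in \<open>auto simp: flat_exp_def\<close>)
    with 3 show ?thesis by (simp add: flat_exp_def)
  qed
qed

lemma continuously_differentiable_flat_exp_compose:
  assumes "\<And>k. continuously_differentiable k s"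
  shows "continuously_differentiable k (\<lambda>z. flat_exp m (s z))"
proof (induction k arbitrary: m)
  case 0
  have "continuous_on UNIV (flat_exp m)"
    by (meson DERIV_continuous_on flat_exp_has_derivative has_field_derivative_at_within)
  then show ?case
    using assms[of 0] continuous_on_compose2 by fastforce
next
  case (Suc k)
  have s: "s differentiable (at z)" for z
    using assms[of "Suc 0"] by simp
  have d: "((\<lambda>z. flat_exp m (s z)) has_derivative
      (\<lambda>v. dderiv v s z * (flat_exp (m + 2) (s z) - m * flat_exp (m + 1) (s z)))) (at z)" for z
    by (rule DERIV_compose_FDERIV[OF flat_exp_has_derivative has_derivative_dderiv[OF s]])
  have "dderiv v (\<lambda>z. flat_exp m (s z)) =
      (\<lambda>z. dderiv v s z * (flat_exp (m + 2) (s z) + (- real m) * flat_exp (m + 1) (s z)))" for v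
    using dderiv_eq[OF d] by auto
  moreover have "continuously_differentiable k (dderiv v s)" for v
    using assms[of "Suc k"] by simp
  ultimately have "continuously_differentiable k (dderiv v (\<lambda>z. flat_exp m (s z)))" for v
    by (simp only:) (intro continuously_differentiable_mult continuously_differentiable_add
        continuously_differentiable_const Suc)
  with d show ?case
    by (auto simp: differentiable_def)
qed

lemma test_functionI:
  assumes "\<And>k. continuously_differentiable k \<psi>" "compact K" "K \<subseteq> unit_disk"
    and "\<And>z. z \<notin> K \<Longrightarrow> \<psi> z = 0"
  shows "test_function \<psi>"
proof -
  have "closure {z. \<psi> z \<noteq> 0} \<subseteq> K"
    using assms by (intro closure_minimal) (auto simp: compact_imp_closed)
  moreover from this have "compact (closure {z. \<psi> z \<noteq> 0})"
    by (metis assms(2) closed_closure compact_Int_closed inf.absorb_iff2)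
  ultimately show ?thesis
    using assms unfolding test_function_def by blast
qed

lemma test_functionE:
  assumes "test_function \<psi>"
  obtains K where "\<And>k. continuously_differentiable k \<psi>" "compact K" "K \<subseteq> unit_disk"
    "\<And>z. z \<notin> K \<Longrightarrow> \<psi> z = 0"
  using assms closure_subset[of "{z. \<psi> z \<noteq> 0}"] unfolding test_function_def by blast

lemma test_function_dderiv:
  assumes "test_function \<psi>"
  shows "test_function (dderiv v \<psi>)"
  using assms
proof (rule test_functionE)
  fix K assume K: "\<And>k. continuously_differentiable k \<psi>" "compact K" "K \<subseteq> unit_disk"
    "\<And>z. z \<notin> K \<Longrightarrow> \<psi> z = 0"
  show ?thesis
  proof (rule test_functionI[OF _ K(2,3)])
    show "continuously_differentiable k (dderiv v \<psi>)" for k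
      using K(1)[of "Suc k"] by simp
    fix z assume "z \<notin> K"
    have "((\<lambda>z. 0) has_derivative (\<lambda>v. 0)) (at z)" by simp
    then have "(\<psi> has_derivative (\<lambda>v. 0)) (at z)"
      by (rule has_derivative_transform_within_open[of _ _ _ _ "- K"])
        (use K \<open>z \<notin> K\<close> in \<open>auto simp: compact_imp_closed open_Compl\<close>)
    then show "dderiv v \<psi> z = 0" by (rule dderiv_eq)
  qed
qed

lemma test_function_differentiable:
  "test_function \<psi> \<Longrightarrow> \<psi> differentiable (at z)"
  unfolding test_function_def by (metis continuously_differentiable.simps(2))

lemma test_function_continuous:
  "test_function \<psi> \<Longrightarrow> continuous_on UNIV \<psi>"
  unfolding test_function_def by (metis continuously_differentiable.simps(1))

lemma test_function_mult_linear:
  assumes "test_function \<psi>" "bounded_linear l"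
  shows "test_function (\<lambda>z. l z * \<psi> z)"
  using assms(1)
proof (rule test_functionE)
  fix K assume K: "\<And>k. continuously_differentiable k \<psi>" "compact K" "K \<subseteq> unit_disk"
    "\<And>z. z \<notin> K \<Longrightarrow> \<psi> z = 0"
  show ?thesis
    by (rule test_functionI[OF _ K(2,3)])
      (simp_all add: K continuously_differentiable_mult
        continuously_differentiable_bounded_linear assms(2))
qed

text \<open>The bump is the flat exponential of \<open>e\<^sup>2 - \<bar>z - a\<bar>\<^sup>2\<close>, a polynomial in the coordinates that is
  positive exactly on the ball.\<close>

lemma ex_bump:
  assumes "0 < e" "cball a e \<subseteq> unit_disk"
  obtains \<psi> where "test_function \<psi>" "\<And>z. \<psi> z \<ge> 0" "\<And>z. \<psi> z > 0 \<longleftrightarrow> z \<in> ball a e"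
proof
  \<comment> \<open>Written with sums and products only, to match the closure lemmas for smooth functions.\<close>
  define s :: "complex \<Rightarrow> real"
    where "s z = e\<^sup>2 + (- 1) * ((Re z + - Re a) * (Re z + - Re a) + (Im z + - Im a) * (Im z + - Im a))" for z
  define \<psi> where "\<psi> z = flat_exp 0 (s z)" for z
  have s: "s z = e\<^sup>2 - (dist a z)\<^sup>2" for z
    unfolding s_def by (simp add: dist_norm cmod_power2) (simp add: power2_eq_square algebra_simps)
  have pos: "s z > 0 \<longleftrightarrow> z \<in> ball a e" for z
    using assms(1) by (auto simp: s power2_strict_mono intro: power2_less_imp_less power_strict_mono)
  show "\<psi> z \<ge> 0" "\<psi> z > 0 \<longleftrightarrow> z \<in> ball a e" for z
    using pos[of z] by (auto simp: \<psi>_def flat_exp_def)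
  have "continuously_differentiable k s" for k
    unfolding s_def
    by (intro continuously_differentiable_add continuously_differentiable_mult
        continuously_differentiable_const continuously_differentiable_bounded_linear
        bounded_linear_Re bounded_linear_Im)
  then have "continuously_differentiable k \<psi>" for k
    unfolding \<psi>_def by (rule continuously_differentiable_flat_exp_compose)
  moreover have "\<psi> z = 0" if "z \<notin> cball a e" for z
    using that pos[of z] by (auto simp: \<psi>_def flat_exp_def)
  ultimately show "test_function \<psi>"
    using assms by (intro test_functionI[of _ "cball a e"]) auto
qed

section \<open>Weak derivatives\<close>

text \<open>The bicomplex norm is not submultiplicative, so \<open>bicomplex\<close> is not a normed algebra; continuity and
  integrability of products are reduced to linear maps \<open>w \<mapsto> c w\<close> and to real scalars.\<close>

lemma bounded_linear_bc_mult: "bounded_linear (\<lambda>w::bicomplex. c * w)"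
  by (simp add: linear_conv_bounded_linear[symmetric] linear_iff distrib_left)

lemma set_integral_bounded_linear:
  fixes f :: "'a \<Rightarrow> 'b::{banach, second_countable_topology}"
    and T :: "'b \<Rightarrow> 'c::{banach, second_countable_topology}"
  assumes "bounded_linear T" "set_integrable M S f"
  shows "set_integrable M S (\<lambda>x. T (f x))"
    and "(LINT x:S|M. T (f x)) = T (LINT x:S|M. f x)"
proof -
  interpret T: bounded_linear T by fact
  have eq: "(\<lambda>x. indicator S x *\<^sub>R T (f x)) = (\<lambda>x. T (indicator S x *\<^sub>R f x))"
    by (simp add: T.scaleR)
  show "set_integrable M S (\<lambda>x. T (f x))"
    using integrable_bounded_linear[OF assms(1)] assms(2)
    unfolding set_integrable_def eq by blast
  show "(LINT x:S|M. T (f x)) = T (LINT x:S|M. f x)"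
    using integral_bounded_linear[OF assms(1)] assms(2)
    unfolding set_lebesgue_integral_def set_integrable_def eq by blast
qed

lemma locally_integrable_add:
  "locally_integrable f \<Longrightarrow> locally_integrable g \<Longrightarrow> locally_integrable (\<lambda>z. f z + g z)"
  by (auto simp: locally_integrable_def)

lemma locally_integrable_bounded_linear:
  "bounded_linear T \<Longrightarrow> locally_integrable f \<Longrightarrow> locally_integrable (\<lambda>z. T (f z))"
  by (auto simp: locally_integrable_def intro: set_integral_bounded_linear)

lemma locally_integrable_cong:
  assumes "\<And>z. z \<in> unit_disk \<Longrightarrow> f z = g z"
  shows "locally_integrable f \<longleftrightarrow> locally_integrable g"
proof -
  have "(\<lambda>z. indicator K z *\<^sub>R f z) = (\<lambda>z. indicator K z *\<^sub>R g z)" if "K \<subseteq> unit_disk" for K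
    using that assms by (intro ext) (auto simp: indicator_def subset_iff)
  then show ?thesis
    unfolding locally_integrable_def set_integrable_def by (metis (no_types, lifting))
qed

lemma locally_integrable_scaleR:
  fixes f :: "complex \<Rightarrow> 'b::{banach, second_countable_topology}"
  assumes u: "continuous_on UNIV u" and f: "locally_integrable f"
  shows "locally_integrable (\<lambda>z. u z *\<^sub>R f z)"
  unfolding locally_integrable_def
proof safe
  fix K :: "complex set" assume K: "compact K" "K \<subseteq> unit_disk"
  have "compact (u ` K)"
    using u K by (meson compact_continuous_image continuous_on_subset subset_UNIV)
  then obtain B where B: "\<And>z. z \<in> K \<Longrightarrow> \<bar>u z\<bar> \<le> B"
    using compact_imp_bounded bounded_iff by (metis image_eqI real_norm_def)
  have int: "integrable lebesgue (\<lambda>z. indicator K z *\<^sub>R f z)"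
    using f K by (auto simp: locally_integrable_def set_integrable_def)
  have "u \<in> borel_measurable lebesgue"
    using borel_measurable_continuous_onI[OF u] by (simp add: measurable_completion)
  then have m: "(\<lambda>z. u z *\<^sub>R (indicator K z *\<^sub>R f z)) \<in> borel_measurable lebesgue"
    by (rule borel_measurable_scaleR[OF _ borel_measurable_integrable[OF int]])
  have "integrable lebesgue (\<lambda>z. u z *\<^sub>R (indicator K z *\<^sub>R f z))"
    by (rule Bochner_Integration.integrable_bound[OF integrable_scaleR_right[OF int, of B] m])
      (use B in \<open>force simp: indicator_def intro!: mult_right_mono\<close>)
  then show "set_integrable lebesgue K (\<lambda>z. u z *\<^sub>R f z)"
    by (simp add: set_integrable_def mult.commute)
qed

lemma test_function_integrable:
  fixes f :: "complex \<Rightarrow> 'b::{banach, second_countable_topology}"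
  assumes "test_function \<psi>" "locally_integrable f"
  shows "set_integrable lebesgue unit_disk (\<lambda>z. \<psi> z *\<^sub>R f z)"
  using assms(1)
proof (rule test_functionE)
  fix K assume K: "compact K" "K \<subseteq> unit_disk" "\<And>z. z \<notin> K \<Longrightarrow> \<psi> z = 0"
  have "set_integrable lebesgue K (\<lambda>z. \<psi> z *\<^sub>R f z)"
    using locally_integrable_scaleR[OF test_function_continuous[OF assms(1)] assms(2)] K
    by (simp add: locally_integrable_def)
  moreover have "(\<lambda>z. indicator unit_disk z *\<^sub>R \<psi> z *\<^sub>R f z) = (\<lambda>z. indicator K z *\<^sub>R \<psi> z *\<^sub>R f z)"
    using K by (auto simp: indicator_def fun_eq_iff)
  ultimately show ?thesis
    by (simp add: set_integrable_def)
qed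

lemma continuous_imp_locally_integrable:
  fixes f :: "complex \<Rightarrow> 'b::euclidean_space"
  assumes "continuous_on unit_disk f"
  shows "locally_integrable f"
  unfolding locally_integrable_def
proof safe
  fix K :: "complex set" assume K: "compact K" "K \<subseteq> unit_disk"
  then have int: "integrable lborel (\<lambda>z. indicator K z *\<^sub>R f z)"
    using assms borel_integrable_compact continuous_on_subset by blast
  show "set_integrable lebesgue K f"
    unfolding set_integrable_def
    by (simp only: integrable_completion[OF borel_measurable_integrable[OF int]] int)
qed

text \<open>If \<open>h a \<noteq> 0\<close>, the scalar function \<open>z \<mapsto> h z \<bullet> h a\<close> is positive near \<open>a\<close>, and so is its integral
  against a bump supported there.\<close>

lemma continuous_eq_0_if_test_integrals_0:
  fixes h :: "complex \<Rightarrow> 'b::euclidean_space"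
  assumes cont: "continuous_on unit_disk h"
    and 0: "\<And>\<psi>. test_function \<psi> \<Longrightarrow> (LINT z:unit_disk|lebesgue. \<psi> z *\<^sub>R h z) = 0"
    and a: "a \<in> unit_disk"
  shows "h a = 0"
proof (rule ccontr)
  assume "h a \<noteq> 0"
  define c where "c z = h z \<bullet> h a" for z
  have "continuous_on unit_disk c"
    unfolding c_def by (intro continuous_intros cont)
  then have "open (unit_disk \<inter> c -` {0<..})"
    by (rule continuous_open_preimage) auto
  moreover have "a \<in> unit_disk \<inter> c -` {0<..}"
    using a \<open>h a \<noteq> 0\<close> by (simp add: c_def)
  ultimately obtain e where e: "e > 0" "cball a e \<subseteq> unit_disk \<inter> c -` {0<..}"
    by (meson open_contains_cball)
  obtain \<psi> where \<psi>: "test_function \<psi>" "\<And>z. \<psi> z \<ge> 0" "\<And>z. \<psi> z > 0 \<longleftrightarrow> z \<in> ball a e"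
    using ex_bump[OF e(1)] e(2) by blast
  have int: "set_integrable lebesgue unit_disk (\<lambda>z. \<psi> z *\<^sub>R h z)"
    by (intro test_function_integrable \<psi> continuous_imp_locally_integrable cont)
  note lin = set_integral_bounded_linear[OF bounded_linear_inner_left int, of "h a"]
  define F where "F = (\<lambda>z. indicator unit_disk z *\<^sub>R ((\<psi> z *\<^sub>R h z) \<bullet> h a))"
  have F: "integrable lebesgue F" "(LINT z|lebesgue. F z) = 0"
    using lin(1) lin(2)[unfolded 0[OF \<psi>(1)]]
    unfolding F_def set_integrable_def set_lebesgue_integral_def by simp_all
  have pos: "F z > 0" if "z \<in> ball a e" for z
    using that \<psi>(3)[of z] e(2) by (auto simp: F_def c_def indicator_def subset_iff)
  have nonneg: "F z \<ge> 0" for z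
  proof (cases "z \<in> ball a e")
    case False
    then have "\<psi> z = 0" using \<psi>(2,3)[of z] by linarith
    then show ?thesis by (simp add: F_def)
  qed (use pos in force)
  have "AE z in lebesgue. F z = 0"
    using F nonneg by (simp add: integral_nonneg_eq_0_iff_AE)
  then have "AE z in lebesgue. z \<notin> ball a e"
    by eventually_elim (use pos in force)
  then have "ball a e \<in> null_sets lebesgue"
    by (simp add: AE_iff_null_sets)
  then have "negligible (ball a e)"
    by (simp add: negligible_iff_null_sets)
  then show False
    using open_not_negligible[of "ball a e"] e(1) by auto
qed

lemma dbar_mult:
  "dbar \<psi> z * w = (dderiv 1 \<psi> z / 2) *\<^sub>R w + (dderiv \<i> \<psi> z / 2) *\<^sub>R (bc_j * w)"
  by (simp add: dbar_def of_real_def algebra_simps)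

lemma dbar_integrable:
  assumes "test_function \<psi>" "locally_integrable f"
  shows "set_integrable lebesgue unit_disk (\<lambda>z. dbar \<psi> z * f z)"
proof -
  have "set_integrable lebesgue unit_disk
      (\<lambda>z. (1/2) *\<^sub>R (dderiv 1 \<psi> z *\<^sub>R f z + dderiv \<i> \<psi> z *\<^sub>R (bc_j * f z)))"
    by (intro set_integrable_scaleR_right set_integral_add(1) test_function_integrable
        test_function_dderiv assms locally_integrable_bounded_linear[OF bounded_linear_bc_mult])
  then show ?thesis
    by (simp add: dbar_mult scaleR_right_distrib)
qed

text \<open>The product rule for a real linear factor; the last bracket is \<open>2 (\<partial> l) w\<close>.\<close>

lemma dbar_mult_linear:
  assumes "test_function \<psi>" "bounded_linear l"
  shows "dbar (\<lambda>z. l z * \<psi> z) z * w =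
    l z *\<^sub>R (dbar \<psi> z * w) + (\<psi> z / 2) *\<^sub>R (l 1 *\<^sub>R w + l \<i> *\<^sub>R (bc_j * w))"
proof -
  have l: "l differentiable (at z)" "dderiv v l z = l v" for v
    using bounded_linear_imp_has_derivative[OF assms(2)]
    by (auto simp: differentiable_def intro: dderiv_eq)
  show ?thesis
    using l test_function_differentiable[OF assms(1)]
    unfolding dbar_mult by (simp add: dderiv_mult algebra_simps add_divide_distrib)
qed

lemma weak_dbar_add:
  assumes "weak_dbar f f'" "weak_dbar g g'"
  shows "weak_dbar (\<lambda>z. f z + g z) (\<lambda>z. f' z + g' z)"
  using assms unfolding weak_dbar_def
  by (auto simp: locally_integrable_add scaleR_right_distrib distrib_left
      set_integral_add(2) test_function_integrable dbar_integrable)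

lemma weak_dbar_scaleR:
  assumes "weak_dbar f f'"
  shows "weak_dbar (\<lambda>z. c *\<^sub>R f z) (\<lambda>z. c *\<^sub>R f' z)"
proof -
  have "\<psi> z *\<^sub>R c *\<^sub>R f' z = c *\<^sub>R (\<psi> z *\<^sub>R f' z)" for \<psi> :: "complex \<Rightarrow> real" and z
    by (simp add: mult.commute)
  moreover have "dbar \<psi> z * (c *\<^sub>R f z) = c *\<^sub>R (dbar \<psi> z * f z)" for \<psi> z
    by simp
  ultimately show ?thesis
    using assms locally_integrable_bounded_linear[OF bounded_linear_scaleR_right, of _ c]
    unfolding weak_dbar_def by (simp only: set_integral_scaleR_right) auto
qed

lemma weak_dbar_zero: "weak_dbar (\<lambda>z. 0) (\<lambda>z. 0)"
  by (simp add: weak_dbar_def continuous_imp_locally_integrable set_lebesgue_integral_def)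

lemma weak_dbar_sum:
  assumes "\<And>i. i \<in> I \<Longrightarrow> weak_dbar (f i) (f' i)"
  shows "weak_dbar (\<lambda>z. \<Sum>i\<in>I. f i z) (\<lambda>z. \<Sum>i\<in>I. f' i z)"
  using assms
  by (induction I rule: infinite_finite_induct) (auto simp: weak_dbar_zero weak_dbar_add)

lemma weak_dbar_cong:
  assumes "\<And>z. z \<in> unit_disk \<Longrightarrow> f z = g z" "\<And>z. z \<in> unit_disk \<Longrightarrow> f' z = g' z"
  shows "weak_dbar f f' \<longleftrightarrow> weak_dbar g g'"
proof -
  have "(LINT z:unit_disk|lebesgue. \<psi> z *\<^sub>R f' z) = (LINT z:unit_disk|lebesgue. \<psi> z *\<^sub>R g' z)"
    "(LINT z:unit_disk|lebesgue. dbar \<psi> z * f z) = (LINT z:unit_disk|lebesgue. dbar \<psi> z * g z)" for \<psi>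
    using assms by (auto intro!: set_lebesgue_integral_cong)
  then show ?thesis
    using locally_integrable_cong[of f g] locally_integrable_cong[of f' g'] assms
    by (simp add: weak_dbar_def)
qed

lemma bc_hat_cnj_mult: "bc_hat (cnj z) * w = Re z *\<^sub>R w - Im z *\<^sub>R (bc_j * w)"
  by (simp add: bc_hat_def of_real_def algebra_simps)

lemma bc_j_bc_j_mult: "bc_j * (bc_j * w) = - w"
  by (simp add: mult.assoc[symmetric] bc_j_square)

text \<open>Test functions are real, so \<open>x - j y\<close> cannot be moved into the test function as it stands. Test
  instead with \<open>x \<psi>\<close> and with \<open>y \<psi>\<close>, and subtract \<open>j\<close> times the second identity from the first: the
  two derivative terms \<open>\<psi> / 2\<close> and \<open>- j\<^sup>2 \<psi> / 2\<close> add up to \<open>\<psi>\<close>, which is \<open>\<partial> (x - j y) = 1\<close>.\<close>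

lemma weak_dbar_bc_hat_mult:
  assumes "weak_dbar f g"
  shows "weak_dbar (\<lambda>z. bc_hat (cnj z) * f z) (\<lambda>z. bc_hat (cnj z) * g z + f z)"
  unfolding weak_dbar_def
proof (intro conjI allI impI)
  have lf: "locally_integrable f" and lg: "locally_integrable g"
    using assms by (auto simp: weak_dbar_def)
  have hat: "locally_integrable (\<lambda>z. bc_hat (cnj z) * u z)" if "locally_integrable u" for u
  proof -
    have "locally_integrable (\<lambda>z. Re z *\<^sub>R u z + (- Im z) *\<^sub>R (bc_j * u z))"
      by (intro locally_integrable_add locally_integrable_scaleR that continuous_intros
          locally_integrable_bounded_linear[OF bounded_linear_bc_mult])
    then show ?thesis by (simp add: bc_hat_cnj_mult)
  qed
  show "locally_integrable (\<lambda>z. bc_hat (cnj z) * f z)"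
    "locally_integrable (\<lambda>z. bc_hat (cnj z) * g z + f z)"
    by (intro hat locally_integrable_add lf lg)+
  fix \<psi> assume \<psi>: "test_function \<psi>"
  define X where "X z = Re z * \<psi> z" for z
  define Y where "Y z = Im z * \<psi> z" for z
  have X: "test_function X" and Y: "test_function Y"
    unfolding X_def Y_def by (intro test_function_mult_linear \<psi> bounded_linear_Re bounded_linear_Im)+
  note j = set_integral_bounded_linear[OF bounded_linear_bc_mult, where c1 = bc_j]
  note int = test_function_integrable[OF X lg] test_function_integrable[OF Y lg]
    test_function_integrable[OF \<psi> lf] dbar_integrable[OF X lf] dbar_integrable[OF Y lf]
  have dX: "dbar X z * w = Re z *\<^sub>R (dbar \<psi> z * w) + (\<psi> z / 2) *\<^sub>R w" for z w
    unfolding X_def by (simp add: dbar_mult_linear[OF \<psi> bounded_linear_Re])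
  have dY: "dbar Y z * w = Im z *\<^sub>R (dbar \<psi> z * w) + (\<psi> z / 2) *\<^sub>R (bc_j * w)" for z w
    unfolding Y_def by (simp add: dbar_mult_linear[OF \<psi> bounded_linear_Im])
  have "\<psi> z *\<^sub>R (bc_hat (cnj z) * g z + f z) =
      X z *\<^sub>R g z - bc_j * (Y z *\<^sub>R g z) + \<psi> z *\<^sub>R f z" for z
    by (simp add: bc_hat_cnj_mult X_def Y_def scaleR_add_right scaleR_diff_right
        mult.commute[of "\<psi> z"])
  then have "(LINT z:unit_disk|lebesgue. \<psi> z *\<^sub>R (bc_hat (cnj z) * g z + f z)) =
      (LINT z:unit_disk|lebesgue. X z *\<^sub>R g z - bc_j * (Y z *\<^sub>R g z) + \<psi> z *\<^sub>R f z)"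
    by simp
  also have "\<dots> = (LINT z:unit_disk|lebesgue. X z *\<^sub>R g z)
      - bc_j * (LINT z:unit_disk|lebesgue. Y z *\<^sub>R g z) + (LINT z:unit_disk|lebesgue. \<psi> z *\<^sub>R f z)"
    by (simp only: set_integral_add(2) set_integral_diff int j)
  also have "\<dots> = - (LINT z:unit_disk|lebesgue. dbar X z * f z)
      + bc_j * (LINT z:unit_disk|lebesgue. dbar Y z * f z) + (LINT z:unit_disk|lebesgue. \<psi> z *\<^sub>R f z)"
    using assms X Y by (simp add: weak_dbar_def)
  also have "\<dots> = - (LINT z:unit_disk|lebesgue.
      dbar X z * f z - bc_j * (dbar Y z * f z) - \<psi> z *\<^sub>R f z)"
    by (simp only: set_integral_diff int j) simp
  also have "(\<lambda>z. dbar X z * f z - bc_j * (dbar Y z * f z) - \<psi> z *\<^sub>R f z) =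
      (\<lambda>z. dbar \<psi> z * (bc_hat (cnj z) * f z))"
  proof
    fix z
    have "dbar X z * f z - bc_j * (dbar Y z * f z) - \<psi> z *\<^sub>R f z =
       Re z *\<^sub>R (dbar \<psi> z * f z) - Im z *\<^sub>R (bc_j * (dbar \<psi> z * f z))
       + ((\<psi> z / 2) *\<^sub>R f z + (\<psi> z / 2) *\<^sub>R f z - \<psi> z *\<^sub>R f z)"
      unfolding dX dY by (simp add: distrib_left bc_j_bc_j_mult)
    also have "\<dots> = Re z *\<^sub>R (dbar \<psi> z * f z) - Im z *\<^sub>R (bc_j * (dbar \<psi> z * f z))"
      by (simp flip: scaleR_left_distrib)
    also have "\<dots> = dbar \<psi> z * (bc_hat (cnj z) * f z)"
      by (simp add: bc_hat_cnj_mult algebra_simps)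
    finally show "dbar X z * f z - bc_j * (dbar Y z * f z) - \<psi> z *\<^sub>R f z = dbar \<psi> z * (bc_hat (cnj z) * f z)" .
  qed
  finally show "(LINT z:unit_disk|lebesgue. \<psi> z *\<^sub>R (bc_hat (cnj z) * g z + f z)) =
      - (LINT z:unit_disk|lebesgue. dbar \<psi> z * (bc_hat (cnj z) * f z))" .
qed

text \<open>For \<open>k = 0\<close> the truncated exponent \<open>k - 1\<close> is harmless, since its coefficient vanishes.\<close>

lemma weak_dbar_bc_hat_power_mult:
  assumes "\<phi> \<in> vekua_solutions A"
  shows "weak_dbar (\<lambda>z. bc_hat (cnj z) ^ k * \<phi> z)
    (\<lambda>z. A z * (bc_hat (cnj z) ^ k * \<phi> z) + real k *\<^sub>R (bc_hat (cnj z) ^ (k - 1) * \<phi> z))"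
proof (induction k)
  case 0
  then show ?case using assms by (simp add: vekua_solutions_def)
next
  case (Suc k)
  have "bc_hat (cnj z) * (A z * (bc_hat (cnj z) ^ k * \<phi> z)
        + real k *\<^sub>R (bc_hat (cnj z) ^ (k - 1) * \<phi> z)) + bc_hat (cnj z) ^ k * \<phi> z =
      A z * (bc_hat (cnj z) ^ Suc k * \<phi> z)
        + real (Suc k) *\<^sub>R (bc_hat (cnj z) ^ (Suc k - 1) * \<phi> z)" for z
    by (cases k) (simp_all add: distrib_left scaleR_left_distrib scaleR_2 ac_simps)
  then show ?case
    using weak_dbar_bc_hat_mult[OF Suc] by (simp only: power_Suc mult.assoc)
qed

lemma weak_dbar_polyanalytic:
  assumes "\<And>k. k < Suc n \<Longrightarrow> \<phi> k \<in> vekua_solutions A"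
  shows "weak_dbar (\<lambda>z. \<Sum>k<Suc n. bc_hat (cnj z) ^ k * \<phi> k z)
    (\<lambda>z. A z * (\<Sum>k<Suc n. bc_hat (cnj z) ^ k * \<phi> k z)
       + (\<Sum>k<n. bc_hat (cnj z) ^ k * (real (Suc k) *\<^sub>R \<phi> (Suc k) z)))"
proof -
  have "(\<Sum>k<Suc n. real k *\<^sub>R (bc_hat (cnj z) ^ (k - 1) * \<phi> k z)) =
      (\<Sum>k<n. bc_hat (cnj z) ^ k * (real (Suc k) *\<^sub>R \<phi> (Suc k) z))" for z
    by (subst sum.lessThan_Suc_shift) simp
  moreover have "weak_dbar (\<lambda>z. \<Sum>k<Suc n. bc_hat (cnj z) ^ k * \<phi> k z)
    (\<lambda>z. \<Sum>k<Suc n. A z * (bc_hat (cnj z) ^ k * \<phi> k z)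
        + real k *\<^sub>R (bc_hat (cnj z) ^ (k - 1) * \<phi> k z))"
    by (intro weak_dbar_sum weak_dbar_bc_hat_power_mult assms) simp
  ultimately show ?thesis
    by (simp only: sum.distrib sum_distrib_left)
qed

text \<open>Only the continuous part \<open>g\<close> of the derivative is determined pointwise: the common summand
  \<open>u\<close>, in the application \<open>A f\<close>, is merely locally integrable and cancels.\<close>

lemma weak_dbar_unique:
  assumes "weak_dbar f (\<lambda>z. u z + g z)" "weak_dbar f' (\<lambda>z. u' z + g' z)"
    and eq: "\<And>z. z \<in> unit_disk \<Longrightarrow> f z = f' z" "\<And>z. z \<in> unit_disk \<Longrightarrow> u z = u' z"
    and cont: "continuous_on unit_disk g" "continuous_on unit_disk g'"
    and z: "z \<in> unit_disk"
  shows "g z = g' z"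
proof -
  have "weak_dbar f' (\<lambda>z. u' z + g z)"
    using assms(1) weak_dbar_cong[of f f' "\<lambda>z. u z + g z" "\<lambda>z. u' z + g z"] eq by simp
  from weak_dbar_add[OF this weak_dbar_scaleR[OF assms(2), of "- 1"]]
  have "weak_dbar (\<lambda>z. 0) (\<lambda>z. g z - g' z)"
    by (simp add: algebra_simps)
  then have "(LINT z:unit_disk|lebesgue. \<psi> z *\<^sub>R (g z - g' z)) = 0" if "test_function \<psi>" for \<psi>
    using that by (simp add: weak_dbar_def set_lebesgue_integral_def)
  from continuous_eq_0_if_test_integrals_0[OF continuous_on_diff[OF cont] this z]
  show ?thesis by simp
qed

section \<open>Hardy classes\<close>

definition hardy_mean :: "real \<Rightarrow> (complex \<Rightarrow> bicomplex) \<Rightarrow> real \<Rightarrow> ennreal" where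
  "hardy_mean p f r = (\<integral>\<^sup>+\<theta>\<in>{0..2*pi}. ennreal (norm (f (of_real r * cis \<theta>)) powr p) \<partial>lborel)"

text \<open>Continuity is part of the definition because it makes the integrands of the means
  measurable, which additivity of the integral requires.\<close>

definition hardy_class :: "real \<Rightarrow> (complex \<Rightarrow> bicomplex) set" where
  "hardy_class p = {f. continuous_on unit_disk f \<and> hardy_norm p f < \<infinity>}"

text \<open>Working with the \<open>p\<close>-th power means avoids the outer root, under which no triangle inequality
  holds for \<open>p < 1\<close>.\<close>

lemma hardy_norm_finite_iff:
  assumes p: "0 < p"
  shows "hardy_norm p f < \<infinity> \<longleftrightarrow> (\<exists>C. \<forall>r\<in>{0<..<1}. hardy_mean p f r \<le> ennreal C)"
proof
  assume "hardy_norm p f < \<infinity>"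
  then obtain M where M: "M \<ge> 0" "hardy_norm p f = ennreal M"
    by (cases "hardy_norm p f") auto
  have "hardy_mean p f r \<le> ennreal (M powr p)" if r: "r \<in> {0<..<1}" for r
  proof -
    have "ennreal_powr (hardy_mean p f r) (1 / p) \<le> ennreal M"
      unfolding M(2)[symmetric] hardy_norm_def hardy_mean_def by (rule SUP_upper[OF r])
    then obtain x where x: "hardy_mean p f r = ennreal x" "x \<ge> 0" "x powr (1 / p) \<le> M"
      using M(1) by (cases "hardy_mean p f r") (auto simp: ennreal_powr_def top_unique)
    have "x = (x powr (1 / p)) powr p"
      using p x by (simp add: powr_powr)
    also have "\<dots> \<le> M powr p"
      using p x by (intro powr_mono2) auto
    finally show ?thesis by (simp add: x ennreal_leI)
  qed
  then show "\<exists>C. \<forall>r\<in>{0<..<1}. hardy_mean p f r \<le> ennreal C" by blast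
next
  assume "\<exists>C. \<forall>r\<in>{0<..<1}. hardy_mean p f r \<le> ennreal C"
  then obtain C where C: "\<And>r. r \<in> {0<..<1} \<Longrightarrow> hardy_mean p f r \<le> ennreal C" by blast
  have "hardy_norm p f \<le> ennreal (max C 0 powr (1 / p))"
    unfolding hardy_norm_def hardy_mean_def[symmetric]
  proof (rule SUP_least)
    fix r :: real assume "r \<in> {0<..<1}"
    then have "hardy_mean p f r \<le> ennreal (max C 0)"
      using C ennreal_leI[of C "max C 0"] by (meson max.cobounded1 order_trans)
    then obtain x where x: "hardy_mean p f r = ennreal x" "x \<ge> 0" "x \<le> max C 0"
      by (cases "hardy_mean p f r") (auto simp: top_unique)
    then show "ennreal_powr (hardy_mean p f r) (1 / p) \<le> ennreal (max C 0 powr (1 / p))"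
      using p by (simp add: ennreal_powr_def powr_mono2 ennreal_leI)
  qed
  then show "hardy_norm p f < \<infinity>"
    by (simp add: order_le_less_trans)
qed

lemma circle_in_disk: "0 < r \<Longrightarrow> r < 1 \<Longrightarrow> of_real r * cis \<theta> \<in> unit_disk"
  by (simp add: norm_mult)

lemma hardy_class_cong:
  assumes "\<And>z. z \<in> unit_disk \<Longrightarrow> f z = g z"
  shows "f \<in> hardy_class p \<longleftrightarrow> g \<in> hardy_class p"
proof -
  have "hardy_norm p f = hardy_norm p g"
    unfolding hardy_norm_def using assms circle_in_disk by (intro SUP_cong) auto
  then show ?thesis
    using continuous_on_cong[of unit_disk unit_disk f g] assms by (simp add: hardy_class_def)
qed

lemma hardy_classI:
  assumes "0 < p" "continuous_on unit_disk f"
    and "\<And>r. 0 < r \<Longrightarrow> r < 1 \<Longrightarrow> hardy_mean p f r \<le> ennreal C"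
  shows "f \<in> hardy_class p"
  unfolding hardy_class_def mem_Collect_eq hardy_norm_finite_iff[OF assms(1)]
  using assms by (auto intro!: exI[of _ C])

lemma hardy_classE:
  assumes "0 < p" "f \<in> hardy_class p"
  obtains C where "0 \<le> C" "\<And>r. 0 < r \<Longrightarrow> r < 1 \<Longrightarrow> hardy_mean p f r \<le> ennreal C"
proof -
  obtain C where C: "\<forall>r\<in>{0<..<1}. hardy_mean p f r \<le> ennreal C"
    using assms(2) hardy_norm_finite_iff[OF assms(1)] unfolding hardy_class_def by blast
  have "hardy_mean p f r \<le> ennreal (max C 0)" if "0 < r" "r < 1" for r
  proof -
    have "hardy_mean p f r \<le> ennreal C" using C that by simp
    also have "\<dots> \<le> ennreal (max C 0)" by (rule ennreal_leI) simp
    finally show ?thesis .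
  qed
  then show ?thesis using that[of "max C 0"] by simp
qed

lemma hardy_mean_integrand_measurable:
  assumes p: "0 < p" and f: "f \<in> hardy_class p" and r: "0 < r" "r < 1"
  shows "(\<lambda>\<theta>. ennreal (norm (f (of_real r * cis \<theta>)) powr p) * indicator {0..2*pi} \<theta>)
    \<in> borel_measurable lborel"
proof -
  have "continuous_on UNIV (\<lambda>\<theta>. f (of_real r * cis \<theta>))"
  proof (rule continuous_on_compose2[of unit_disk f UNIV "\<lambda>\<theta>. of_real r * cis \<theta>"])
    show "continuous_on unit_disk f" using f by (simp add: hardy_class_def)
    show "continuous_on UNIV (\<lambda>\<theta>. of_real r * cis \<theta>)"
      by (intro continuous_intros)
  qed (use r circle_in_disk in blast)
  then have "continuous_on UNIV (\<lambda>\<theta>. norm (f (of_real r * cis \<theta>)) powr p)"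
    using p by (intro continuous_on_powr' continuous_on_norm continuous_on_const) auto
  then have "(\<lambda>\<theta>. norm (f (of_real r * cis \<theta>)) powr p) \<in> borel_measurable lborel"
    by (simp add: borel_measurable_continuous_onI)
  then show ?thesis
    by (intro borel_measurable_times_ennreal measurable_compose[OF _ measurable_ennreal]
        borel_measurable_indicator) auto
qed

lemma hardy_class_dominated:
  assumes p: "0 < p" and f: "f \<in> hardy_class p" and g: "continuous_on unit_disk g" and c: "0 \<le> c"
    and le: "\<And>z. z \<in> unit_disk \<Longrightarrow> norm (g z) \<le> c * norm (f z)"
  shows "g \<in> hardy_class p"
proof -
  obtain C where C: "0 \<le> C" "\<And>r. 0 < r \<Longrightarrow> r < 1 \<Longrightarrow> hardy_mean p f r \<le> ennreal C"
    using hardy_classE[OF p f] by blast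
  show ?thesis
  proof (rule hardy_classI[OF p g])
    fix r :: real assume r: "0 < r" "r < 1"
    note m = hardy_mean_integrand_measurable[OF p f r]
    have "norm (g z) powr p \<le> c powr p * norm (f z) powr p" if "z \<in> unit_disk" for z
      using p c le[OF that] powr_mono2[of p "norm (g z)" "c * norm (f z)"] by (simp add: powr_mult)
    then have "hardy_mean p g r \<le> (\<integral>\<^sup>+\<theta>. ennreal (c powr p) *
        (ennreal (norm (f (of_real r * cis \<theta>)) powr p) * indicator {0..2*pi} \<theta>) \<partial>lborel)"
      unfolding hardy_mean_def using circle_in_disk[OF r]
      by (intro nn_integral_mono)
        (auto simp: indicator_def ennreal_mult[symmetric] intro!: ennreal_leI)
    also have "\<dots> = ennreal (c powr p) * hardy_mean p f r"
      unfolding hardy_mean_def using m by (rule nn_integral_cmult)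
    also have "\<dots> \<le> ennreal (c powr p) * ennreal C"
      by (intro mult_left_mono C r) simp
    finally show "hardy_mean p g r \<le> ennreal (c powr p * C)" by (simp add: ennreal_mult')
  qed
qed

text \<open>The pointwise bound \<open>\<parallel>v + w\<parallel>\<^sup>p \<le> 2\<^sup>p (\<parallel>v\<parallel>\<^sup>p + \<parallel>w\<parallel>\<^sup>p)\<close>, valid for every \<open>p > 0\<close>, replaces
  Minkowski's inequality.\<close>

lemma hardy_class_add:
  assumes p: "0 < p" and f: "f \<in> hardy_class p" and g: "g \<in> hardy_class p"
  shows "(\<lambda>z. f z + g z) \<in> hardy_class p"
proof -
  obtain C where C: "0 \<le> C" "\<And>r. 0 < r \<Longrightarrow> r < 1 \<Longrightarrow> hardy_mean p f r \<le> ennreal C"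
    using hardy_classE[OF p f] by blast
  obtain D where D: "0 \<le> D" "\<And>r. 0 < r \<Longrightarrow> r < 1 \<Longrightarrow> hardy_mean p g r \<le> ennreal D"
    using hardy_classE[OF p g] by blast
  have ineq: "norm (v + w) powr p \<le> 2 powr p * (norm v powr p + norm w powr p)" for v w :: bicomplex
  proof -
    have "norm (v + w) \<le> 2 * max (norm v) (norm w)"
      using norm_triangle_ineq[of v w] by linarith
    then have "norm (v + w) powr p \<le> (2 * max (norm v) (norm w)) powr p"
      using p by (intro powr_mono2) auto
    also have "\<dots> = 2 powr p * max (norm v) (norm w) powr p"
      by (simp add: powr_mult)
    also have "max (norm v) (norm w) powr p \<le> norm v powr p + norm w powr p"
      by (simp add: max_def)
    finally show ?thesis by simp
  qed
  show ?thesis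
  proof (rule hardy_classI[OF p])
    show "continuous_on unit_disk (\<lambda>z. f z + g z)"
      using f g by (auto simp: hardy_class_def intro!: continuous_intros)
    fix r :: real assume r: "0 < r" "r < 1"
    note m = hardy_mean_integrand_measurable[OF p f r] hardy_mean_integrand_measurable[OF p g r]
    have "hardy_mean p (\<lambda>z. f z + g z) r \<le> (\<integral>\<^sup>+\<theta>. ennreal (2 powr p) *
        (ennreal (norm (f (of_real r * cis \<theta>)) powr p) * indicator {0..2*pi} \<theta> +
         ennreal (norm (g (of_real r * cis \<theta>)) powr p) * indicator {0..2*pi} \<theta>) \<partial>lborel)"
      unfolding hardy_mean_def
      by (intro nn_integral_mono)
        (auto simp: indicator_def ennreal_mult[symmetric] ennreal_plus[symmetric] ineq
          simp del: ennreal_plus intro!: ennreal_leI)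
    also have "\<dots> = ennreal (2 powr p) * (hardy_mean p f r + hardy_mean p g r)"
      unfolding hardy_mean_def using m by (simp add: nn_integral_cmult nn_integral_add)
    also have "\<dots> \<le> ennreal (2 powr p) * (ennreal C + ennreal D)"
      by (intro mult_left_mono add_mono C D r) simp
    finally show "hardy_mean p (\<lambda>z. f z + g z) r \<le> ennreal (2 powr p * (C + D))"
      using C D by (simp add: ennreal_mult')
  qed
qed

lemma hardy_class_scaleR:
  assumes "0 < p" "f \<in> hardy_class p"
  shows "(\<lambda>z. c *\<^sub>R f z) \<in> hardy_class p"
  by (rule hardy_class_dominated[OF assms, where c = "\<bar>c\<bar>"])
    (use assms in \<open>auto simp: hardy_class_def intro!: continuous_intros\<close>)

text \<open>The idempotent components of \<open>x - j y\<close> are \<open>z\<close> and its conjugate, which have the same modulus.\<close>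

lemma norm_bc_hat_cnj_mult: "norm (bc_hat (cnj z) * w) = norm z * norm w"
proof -
  have "bc_plus (bc_hat (cnj z) * w) = z * bc_plus w"
    "bc_minus (bc_hat (cnj z) * w) = cnj z * bc_minus w"
    by (auto simp: bc_hat_def of_real_def bc_plus_def bc_minus_def bc_j_def complex_eq_iff algebra_simps)
  then have "norm (bc_hat (cnj z) * w) =
      sqrt ((norm z)\<^sup>2 * (((cmod (bc_plus w))\<^sup>2 + (cmod (bc_minus w))\<^sup>2) / 2))"
    by (simp add: norm_bicomplex_def norm_mult power_mult_distrib algebra_simps)
  then show ?thesis
    by (simp only: real_sqrt_mult norm_bicomplex_def) simp
qed

lemma continuous_on_bc_hat_mult:
  assumes "continuous_on S f"
  shows "continuous_on S (\<lambda>z. bc_hat (cnj z) * f z)"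
proof -
  have "continuous_on S (\<lambda>z. bc_j * f z)"
    by (rule bounded_linear.continuous_on[OF bounded_linear_bc_mult assms])
  then show ?thesis
    unfolding bc_hat_cnj_mult by (intro continuous_intros assms)
qed

lemma continuous_on_bc_hat_power_mult:
  assumes "continuous_on S f"
  shows "continuous_on S (\<lambda>z. bc_hat (cnj z) ^ k * f z)"
  using assms by (induction k) (auto simp: mult.assoc continuous_on_bc_hat_mult)

lemma hardy_class_bc_hat_mult:
  assumes "0 < p" "f \<in> hardy_class p"
  shows "(\<lambda>z. bc_hat (cnj z) * f z) \<in> hardy_class p"
  by (rule hardy_class_dominated[OF assms, where c = 1])
    (use assms in \<open>auto simp: hardy_class_def norm_bc_hat_cnj_mult continuous_on_bc_hat_mult
      intro!: mult_left_le_one_le\<close>)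

lemma hardy_class_polyanalytic:
  assumes p: "0 < p" and "\<And>k. k < n \<Longrightarrow> \<phi> k \<in> hardy_class p"
  shows "(\<lambda>z. \<Sum>k<n. bc_hat (cnj z) ^ k * \<phi> k z) \<in> hardy_class p"
  using assms(2)
proof (induction n arbitrary: \<phi>)
  case 0
  show ?case
    by (rule hardy_classI[OF p, where C = 0]) (simp_all add: hardy_mean_def)
next
  case (Suc n)
  have "(\<lambda>z. \<phi> 0 z + bc_hat (cnj z) * (\<Sum>k<n. bc_hat (cnj z) ^ k * \<phi> (Suc k) z)) \<in> hardy_class p"
    using Suc.prems
    by (intro hardy_class_add[OF p] hardy_class_bc_hat_mult[OF p] Suc.IH) auto
  then show ?case
    by (subst sum.lessThan_Suc_shift) (simp add: sum_distrib_left mult.assoc)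
qed

section \<open>The meta-Hardy classes\<close>

lemma vekua_hardy_iff: "\<phi> \<in> vekua_hardy p A \<longleftrightarrow> \<phi> \<in> vekua_solutions A \<and> \<phi> \<in> hardy_class p"
  by (auto simp: vekua_hardy_def hardy_class_def vekua_solutions_def)

lemma vekua_solutions_scaleR:
  "\<phi> \<in> vekua_solutions A \<Longrightarrow> (\<lambda>z. c *\<^sub>R \<phi> z) \<in> vekua_solutions A"
  using weak_dbar_scaleR[of \<phi> _ c] by (auto simp: vekua_solutions_def intro!: continuous_intros)

text \<open>The iterates start with \<open>f\<close> as a total function, so for a change of \<open>f\<close> off the disk the witness
  has to be changed in its first entry.\<close>

lemma meta_vekua_hardy_cong:
  assumes f: "f \<in> meta_vekua_hardy n p A" and eq: "\<And>z. z \<in> unit_disk \<Longrightarrow> f z = f' z"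
  shows "f' \<in> meta_vekua_hardy n p A"
proof -
  obtain g where g: "vekua_iterates A n f g" "\<forall>z\<in>unit_disk. g n z = 0"
    "(\<Sum>k<n. hardy_norm p (g k)) < \<infinity>"
    using f by (auto simp: meta_vekua_hardy_def)
  define g' where "g' = g(0 := f')"
  have g': "g' k z = g k z" if "z \<in> unit_disk" for k z
    using that eq g(1) by (simp add: g'_def vekua_iterates_def)
  have "hardy_norm p (g' k) = hardy_norm p (g k)" for k
    unfolding hardy_norm_def using g' circle_in_disk by (intro SUP_cong) auto
  moreover have "continuous_on unit_disk (g' k) \<longleftrightarrow> continuous_on unit_disk (g k)" for k
    using g' by (intro continuous_on_cong) auto
  moreover have "weak_dbar (g' k) (\<lambda>z. A z * g' k z + g' (Suc k) z) \<longleftrightarrow>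
      weak_dbar (g k) (\<lambda>z. A z * g k z + g (Suc k) z)" for k
    using g' by (intro weak_dbar_cong) auto
  moreover have "g' 0 = f'" by (simp add: g'_def)
  ultimately have "vekua_iterates A n f' g' \<and> (\<forall>z\<in>unit_disk. g' n z = 0) \<and>
      (\<Sum>k<n. hardy_norm p (g' k)) < \<infinity>"
    using g g' by (simp add: vekua_iterates_def)
  then show ?thesis by (auto simp: meta_vekua_hardy_def)
qed

text \<open>A sequence of iterates for \<open>f\<close> is \<open>f\<close> followed by one for \<open>g 1\<close>, and uniqueness of the continuous
  weak derivative forces \<open>g 1 = h\<close> on the disk.\<close>

lemma meta_vekua_hardy_Suc_iff:
  assumes f: "continuous_on unit_disk f" and h: "continuous_on unit_disk h"
    and fh: "weak_dbar f (\<lambda>z. A z * f z + h z)"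
  shows "f \<in> meta_vekua_hardy (Suc n) p A \<longleftrightarrow> f \<in> hardy_class p \<and> h \<in> meta_vekua_hardy n p A"
proof
  assume "f \<in> meta_vekua_hardy (Suc n) p A"
  then obtain g where g: "vekua_iterates A (Suc n) f g" "\<forall>z\<in>unit_disk. g (Suc n) z = 0"
    "(\<Sum>k<Suc n. hardy_norm p (g k)) < \<infinity>"
    by (auto simp: meta_vekua_hardy_def)
  have sum: "hardy_norm p f + (\<Sum>k<n. hardy_norm p (g (Suc k))) < \<infinity>"
    using g(1,3) by (subst (asm) sum.lessThan_Suc_shift) (simp add: vekua_iterates_def)
  have "vekua_iterates A n (g (Suc 0)) (\<lambda>k. g (Suc k))"
    using g(1) by (auto simp: vekua_iterates_def)
  then have "g (Suc 0) \<in> meta_vekua_hardy n p A"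
    using g(2) sum by (auto simp: meta_vekua_hardy_def)
  moreover have "g (Suc 0) z = h z" if "z \<in> unit_disk" for z
  proof (rule weak_dbar_unique[OF _ fh _ _ _ h that])
    show "weak_dbar f (\<lambda>z. A z * f z + g (Suc 0) z)" "continuous_on unit_disk (g (Suc 0))"
      using g(1) by (auto simp: vekua_iterates_def)
  qed auto
  ultimately have "h \<in> meta_vekua_hardy n p A"
    by (rule meta_vekua_hardy_cong)
  then show "f \<in> hardy_class p \<and> h \<in> meta_vekua_hardy n p A"
    using sum f by (simp add: hardy_class_def)
next
  assume R: "f \<in> hardy_class p \<and> h \<in> meta_vekua_hardy n p A"
  then obtain g where g: "vekua_iterates A n h g" "\<forall>z\<in>unit_disk. g n z = 0"
    "(\<Sum>k<n. hardy_norm p (g k)) < \<infinity>"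
    by (auto simp: meta_vekua_hardy_def)
  define g' where "g' = case_nat f g"
  have [simp]: "g' 0 = f" "g' (Suc k) = g k" for k
    by (simp_all add: g'_def)
  have "continuous_on unit_disk (g' k)" if "k \<le> Suc n" for k
    using g(1) f that by (cases k) (auto simp: vekua_iterates_def)
  moreover have "weak_dbar (g' k) (\<lambda>z. A z * g' k z + g' (Suc k) z)" if "k < Suc n" for k
    using g(1) fh that by (cases k) (auto simp: vekua_iterates_def)
  ultimately have "vekua_iterates A (Suc n) f g'"
    by (simp add: vekua_iterates_def)
  moreover have "(\<Sum>k<Suc n. hardy_norm p (g' k)) < \<infinity>"
    by (subst sum.lessThan_Suc_shift) (use R g(3) in \<open>simp add: hardy_class_def\<close>)
  ultimately show "f \<in> meta_vekua_hardy (Suc n) p A"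
    using g(2) unfolding meta_vekua_hardy_def by (intro CollectI exI[of _ g']) simp
qed

text \<open>The induction runs over all coefficient families at once, since the induction hypothesis is
  applied to the shifted and rescaled family \<open>(k + 1) \<phi>\<^sub>k\<^sub>+\<^sub>1\<close>. It starts at \<open>n = 0\<close>, where the sum is empty
  and both sides hold trivially.\<close>

lemma meta_vekua_hardy_iff_components:
  assumes p: "0 < p" and "\<And>k. k < n \<Longrightarrow> \<phi> k \<in> vekua_solutions A"
  shows "(\<lambda>z. \<Sum>k<n. bc_hat (cnj z) ^ k * \<phi> k z) \<in> meta_vekua_hardy n p A \<longleftrightarrow>
    (\<forall>k<n. \<phi> k \<in> hardy_class p)"
  using assms(2)
proof (induction n arbitrary: \<phi>)
  case 0
  have "vekua_iterates A 0 (\<lambda>z. 0) (\<lambda>k z. 0)"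
    by (simp add: vekua_iterates_def)
  then show ?case by (auto simp: meta_vekua_hardy_def)
next
  case (Suc n)
  let ?f = "\<lambda>z. \<Sum>k<Suc n. bc_hat (cnj z) ^ k * \<phi> k z"
  let ?h = "\<lambda>z. \<Sum>k<n. bc_hat (cnj z) ^ k * (real (Suc k) *\<^sub>R \<phi> (Suc k) z)"
  let ?g = "\<lambda>z. \<Sum>k<n. bc_hat (cnj z) ^ k * \<phi> (Suc k) z"
  have cont: "continuous_on unit_disk (\<phi> k)" if "k < Suc n" for k
    using Suc.prems[OF that] by (simp add: vekua_solutions_def)
  have scale: "(\<lambda>z. real (Suc k) *\<^sub>R \<phi> (Suc k) z) \<in> hardy_class p \<longleftrightarrow> \<phi> (Suc k) \<in> hardy_class p" for k
    using hardy_class_scaleR[OF p, of "\<phi> (Suc k)" "real (Suc k)"]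
      hardy_class_scaleR[OF p, of "\<lambda>z. real (Suc k) *\<^sub>R \<phi> (Suc k) z" "inverse (real (Suc k))"] by auto
  have "?f \<in> meta_vekua_hardy (Suc n) p A \<longleftrightarrow> ?f \<in> hardy_class p \<and> ?h \<in> meta_vekua_hardy n p A"
    by (intro meta_vekua_hardy_Suc_iff weak_dbar_polyanalytic Suc.prems continuous_on_sum
        continuous_on_bc_hat_power_mult continuous_on_scaleR continuous_on_const cont) auto
  also have "?h \<in> meta_vekua_hardy n p A \<longleftrightarrow> (\<forall>k<n. \<phi> (Suc k) \<in> hardy_class p)"
    unfolding scale[symmetric]
    by (intro Suc.IH vekua_solutions_scaleR Suc.prems) simp
  also have "?f \<in> hardy_class p \<and> (\<forall>k<n. \<phi> (Suc k) \<in> hardy_class p) \<longleftrightarrow>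
      (\<forall>k<Suc n. \<phi> k \<in> hardy_class p)"
  proof safe
    fix k assume f: "?f \<in> hardy_class p" and tail: "\<forall>k<n. \<phi> (Suc k) \<in> hardy_class p" and k: "k < Suc n"
    have "?f z = \<phi> 0 z + bc_hat (cnj z) * ?g z" for z
      by (subst sum.lessThan_Suc_shift) (simp add: sum_distrib_left mult.assoc)
    then have eq: "\<phi> 0 = (\<lambda>z. ?f z + (- 1) *\<^sub>R (bc_hat (cnj z) * ?g z))"
      by (simp add: fun_eq_iff del: sum.lessThan_Suc)
    have "\<phi> 0 \<in> hardy_class p"
      using tail by (subst eq) (intro hardy_class_add hardy_class_scaleR hardy_class_bc_hat_mult
          hardy_class_polyanalytic p f, auto)
    with tail k show "\<phi> k \<in> hardy_class p" by (cases k) auto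
  qed (auto intro: hardy_class_polyanalytic[OF p] simp del: sum.lessThan_Suc)
  finally show ?case .
qed

theorem theorem6p4:
  fixes p :: real and q :: ereal and n :: nat
    and A f :: "complex \<Rightarrow> bicomplex" and \<phi> :: "nat \<Rightarrow> complex \<Rightarrow> bicomplex"
  assumes "0 < p" and "1 \<le> n" and "2 < q"
    and "A \<in> sobolev_disk_bc (n - 1) q"
    and "\<And>k. k < n \<Longrightarrow> \<phi> k \<in> vekua_solutions A"
    and "\<And>z. z \<in> unit_disk \<Longrightarrow> f z = (\<Sum>k<n. bc_hat (cnj z) ^ k * \<phi> k z)"
  shows "f \<in> meta_vekua_hardy n p A \<longleftrightarrow> (\<forall>k<n. \<phi> k \<in> vekua_hardy p A)"
proof -
  have "f \<in> meta_vekua_hardy n p A \<longleftrightarrow>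
      (\<lambda>z. \<Sum>k<n. bc_hat (cnj z) ^ k * \<phi> k z) \<in> meta_vekua_hardy n p A"
    by (rule iffI; erule meta_vekua_hardy_cong) (simp_all only: assms(6))
  also have "\<dots> \<longleftrightarrow> (\<forall>k<n. \<phi> k \<in> vekua_hardy p A)"
    using meta_vekua_hardy_iff_components[OF assms(1,5)] assms(5) by (simp add: vekua_hardy_iff)
  finally show ?thesis .
qed

end
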